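(* Let $\mathbf a\in\mathbb C^2$. If $\mathbf a\ne\mathbf 0=(0,0)$, then the category $\Omega^{\bar S_2}_{\mathbf a}$ is equivalent to $\Omega^{\bar S_2}_{\mathbf 1}$, where $\mathbf 1=(1,1)$.
   Context: $\bar S_2$ is the complex Lie algebra of polynomial vector fields $p_1\partial_1+p_2\partial_2$, $p_i\in\mathbb C[t_1,t_2]$, $\partial_i=\partial/\partial t_i$, with constant divergence $\partial_1(p_1)+\partial_2(p_2)\in\mathbb C$. Let $\Delta_2=\mathrm{span}\{\partial_1,\partial_2\}$, and for $\mathbf a=(a_1,a_2)\in\mathbb C^2$ let $\phi_{\mathbf a}:\Delta_2\to\mathbb C$ be the linear map with $\phi_{\mathbf a}(\partial_i)=a_i$. An $\bar S_2$-module $M$ is a Whittaker module if $\Delta_2$ acts locally finitely on it; it is of type $\phi_{\mathbf a}$ if for every $v\in M$ and $x\in\Delta_2$, $(x-\phi_{\mathbf a}(x))^kv=0$ for some $k\in\mathbb N$. $\mathrm{Wh}_{\mathbf a}(M)=\{v\in M:\partial_iv=a_iv,\ i=1,2\}$. $\Omega^{\bar S_2}_{\mathbf a}$ is the category of Whittaker $\bar S_2$-modules $M$ of type $\phi_{\mathbf a}$ with $\dim\mathrm{Wh}_{\mathbf a}(M)<\infty$. *)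

theory Defs
  imports
    "Jordan_Normal_Form.VS_Connect"
    "HOL-Computational_Algebra.Polynomial"
    "HOL-Library.Product_Plus"
    "HOL-Library.FuncSet"
begin

section \<open>Categories and equivalence of categories\<close>

text \<open>
  Hom-sets need not be disjoint, so composition and the morphism part of a functor take the
  objects involved as arguments: \<open>cmp C X Y Z g f\<close> is the composite of \<open>f : X \<rightarrow> Y\<close> and
  \<open>g : Y \<rightarrow> Z\<close>.
\<close>

record ('o, 'm) cat =
  Obj :: "'o set"
  Hom :: "'o \<Rightarrow> 'o \<Rightarrow> 'm set"
  idn :: "'o \<Rightarrow> 'm"
  cmp :: "'o \<Rightarrow> 'o \<Rightarrow> 'o \<Rightarrow> 'm \<Rightarrow> 'm \<Rightarrow> 'm"

locale category =
  fixes C :: "('o, 'm) cat"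
  assumes idn_in_Hom: "X \<in> Obj C \<Longrightarrow> idn C X \<in> Hom C X X"
    and cmp_in_Hom:
      "\<lbrakk>X \<in> Obj C; Y \<in> Obj C; Z \<in> Obj C; f \<in> Hom C X Y; g \<in> Hom C Y Z\<rbrakk>
        \<Longrightarrow> cmp C X Y Z g f \<in> Hom C X Z"
    and cmp_idn_right:
      "\<lbrakk>X \<in> Obj C; Y \<in> Obj C; f \<in> Hom C X Y\<rbrakk> \<Longrightarrow> cmp C X X Y f (idn C X) = f"
    and cmp_idn_left:
      "\<lbrakk>X \<in> Obj C; Y \<in> Obj C; f \<in> Hom C X Y\<rbrakk> \<Longrightarrow> cmp C X Y Y (idn C Y) f = f"
    and cmp_assoc:
      "\<lbrakk>W \<in> Obj C; X \<in> Obj C; Y \<in> Obj C; Z \<in> Obj C;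
        f \<in> Hom C W X; g \<in> Hom C X Y; h \<in> Hom C Y Z\<rbrakk>
        \<Longrightarrow> cmp C W X Z (cmp C X Y Z h g) f = cmp C W Y Z h (cmp C W X Y g f)"

definition iso_in :: "('o, 'm) cat \<Rightarrow> 'o \<Rightarrow> 'o \<Rightarrow> 'm \<Rightarrow> bool" where
  "iso_in C X Y f \<longleftrightarrow> f \<in> Hom C X Y \<and>
     (\<exists>g \<in> Hom C Y X. cmp C X Y X g f = idn C X \<and> cmp C Y X Y f g = idn C Y)"

definition is_functor ::
  "('o, 'm) cat \<Rightarrow> ('p, 'n) cat \<Rightarrow> ('o \<Rightarrow> 'p) \<Rightarrow> ('o \<Rightarrow> 'o \<Rightarrow> 'm \<Rightarrow> 'n) \<Rightarrow> bool" where
  "is_functor C D Fo Fm \<longleftrightarrow>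
     (\<forall>X \<in> Obj C. Fo X \<in> Obj D) \<and>
     (\<forall>X \<in> Obj C. \<forall>Y \<in> Obj C. \<forall>f \<in> Hom C X Y. Fm X Y f \<in> Hom D (Fo X) (Fo Y)) \<and>
     (\<forall>X \<in> Obj C. Fm X X (idn C X) = idn D (Fo X)) \<and>
     (\<forall>X \<in> Obj C. \<forall>Y \<in> Obj C. \<forall>Z \<in> Obj C. \<forall>f \<in> Hom C X Y. \<forall>g \<in> Hom C Y Z.
        Fm X Z (cmp C X Y Z g f) = cmp D (Fo X) (Fo Y) (Fo Z) (Fm Y Z g) (Fm X Y f))"

definition is_nat_iso ::
  "('o, 'm) cat \<Rightarrow> ('p, 'n) cat \<Rightarrow> ('o \<Rightarrow> 'p) \<Rightarrow> ('o \<Rightarrow> 'o \<Rightarrow> 'm \<Rightarrow> 'n) \<Rightarrow>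
     ('o \<Rightarrow> 'p) \<Rightarrow> ('o \<Rightarrow> 'o \<Rightarrow> 'm \<Rightarrow> 'n) \<Rightarrow> ('o \<Rightarrow> 'n) \<Rightarrow> bool" where
  "is_nat_iso C D Fo Fm Go Gm \<eta> \<longleftrightarrow>
     (\<forall>X \<in> Obj C. iso_in D (Fo X) (Go X) (\<eta> X)) \<and>
     (\<forall>X \<in> Obj C. \<forall>Y \<in> Obj C. \<forall>f \<in> Hom C X Y.
        cmp D (Fo X) (Fo Y) (Go Y) (\<eta> Y) (Fm X Y f) =
        cmp D (Fo X) (Go X) (Go Y) (Gm X Y f) (\<eta> X))"

definition equivalent_categories :: "('o, 'm) cat \<Rightarrow> ('p, 'n) cat \<Rightarrow> bool" where
  "equivalent_categories C D \<longleftrightarrow> category C \<and> category D \<and>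
     (\<exists>Fo Fm Go Gm \<eta> \<epsilon>.
        is_functor C D Fo Fm \<and> is_functor D C Go Gm \<and>
        is_nat_iso C C (\<lambda>X. X) (\<lambda>X Y f. f)
          (\<lambda>X. Go (Fo X)) (\<lambda>X Y f. Gm (Fo X) (Fo Y) (Fm X Y f)) \<eta> \<and>
        is_nat_iso D D (\<lambda>X. Fo (Go X)) (\<lambda>X Y f. Fm (Go X) (Go Y) (Gm X Y f))
          (\<lambda>X. X) (\<lambda>X Y f. f) \<epsilon>)"

section \<open>The Lie algebra of polynomial vector fields with constant divergence\<close>

text \<open>
  The ring \<open>\<complex>[t\<^sub>1, t\<^sub>2]\<close> is rendered as \<open>\<complex>[t\<^sub>1][t\<^sub>2]\<close>: the outer variable is \<open>t\<^sub>2\<close>,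
  the coefficients are polynomials in \<open>t\<^sub>1\<close>.  The pair \<open>(p\<^sub>1, p\<^sub>2)\<close> stands for
  \<open>p\<^sub>1 \<partial>\<^sub>1 + p\<^sub>2 \<partial>\<^sub>2\<close>.
\<close>

type_synonym bipoly = "complex poly poly"
type_synonym vfield = "bipoly \<times> bipoly"

definition const2 :: "complex \<Rightarrow> bipoly" where
  "const2 c = [:[:c:]:]"

definition pd1 :: "bipoly \<Rightarrow> bipoly" where
  "pd1 p = map_poly pderiv p"

definition pd2 :: "bipoly \<Rightarrow> bipoly" where
  "pd2 p = pderiv p"

definition vf_scale :: "complex \<Rightarrow> vfield \<Rightarrow> vfield" where
  "vf_scale c x = (const2 c * fst x, const2 c * snd x)"

definition vf_apply :: "vfield \<Rightarrow> bipoly \<Rightarrow> bipoly" where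
  "vf_apply x f = fst x * pd1 f + snd x * pd2 f"

definition vf_bracket :: "vfield \<Rightarrow> vfield \<Rightarrow> vfield" where
  "vf_bracket x y =
     (vf_apply x (fst y) - vf_apply y (fst x), vf_apply x (snd y) - vf_apply y (snd x))"

definition divergence :: "vfield \<Rightarrow> bipoly" where
  "divergence x = pd1 (fst x) + pd2 (snd x)"

definition sbar2 :: "vfield set" where
  "sbar2 = {x. divergence x \<in> range const2}"

definition d1 :: vfield where "d1 = (1, 0)"
definition d2 :: vfield where "d2 = (0, 1)"

definition delta2 :: "vfield set" where
  "delta2 = {vf_scale c1 d1 + vf_scale c2 d2 | c1 c2. True}"

text \<open>Only the values of \<open>phi a\<close> on \<^const>\<open>delta2\<close>, whose elements have constant
  coefficients, are ever used.\<close>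

definition phi :: "complex \<times> complex \<Rightarrow> vfield \<Rightarrow> complex" where
  "phi a x = coeff (coeff (fst x) 0) 0 * fst a + coeff (coeff (snd x) 0) 0 * snd a"

section \<open>Modules and Whittaker modules\<close>

text \<open>
  The underlying vector space is a HOL-Algebra module over \<open>class_ring\<close>, the field of
  complex numbers as a record.  The record fields for a multiplication and a unit that
  \<^typ>\<open>('a, 'b) module\<close> inherits from rings play no role, and \<open>act\<close> matters only on
  \<open>sbar2\<close> and on the carrier.
\<close>

record 'v sbar2_mod = "(complex, 'v) module" +
  act :: "vfield \<Rightarrow> 'v \<Rightarrow> 'v"

locale sbar2_module = vectorspace "class_ring :: complex ring" M
  for M :: "'v sbar2_mod" (structure) +
  assumes act_closed: "\<lbrakk>x \<in> sbar2; v \<in> carrier M\<rbrakk> \<Longrightarrow> act M x v \<in> carrier M"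
    and act_add_right:
      "\<lbrakk>x \<in> sbar2; v \<in> carrier M; w \<in> carrier M\<rbrakk>
        \<Longrightarrow> act M x (v \<oplus>\<^bsub>M\<^esub> w) = act M x v \<oplus>\<^bsub>M\<^esub> act M x w"
    and act_smult_right:
      "\<lbrakk>x \<in> sbar2; v \<in> carrier M\<rbrakk> \<Longrightarrow> act M x (c \<odot>\<^bsub>M\<^esub> v) = c \<odot>\<^bsub>M\<^esub> act M x v"
    and act_add_left:
      "\<lbrakk>x \<in> sbar2; y \<in> sbar2; v \<in> carrier M\<rbrakk>
        \<Longrightarrow> act M (x + y) v = act M x v \<oplus>\<^bsub>M\<^esub> act M y v"
    and act_scale_left:
      "\<lbrakk>x \<in> sbar2; v \<in> carrier M\<rbrakk> \<Longrightarrow> act M (vf_scale c x) v = c \<odot>\<^bsub>M\<^esub> act M x v"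
    and act_bracket:
      "\<lbrakk>x \<in> sbar2; y \<in> sbar2; v \<in> carrier M\<rbrakk>
        \<Longrightarrow> act M (vf_bracket x y) v = act M x (act M y v) \<ominus>\<^bsub>M\<^esub> act M y (act M x v)"

text \<open>Homomorphisms are made extensional so that they are determined by their values on
  the carrier.\<close>

definition sbar2_hom :: "'v sbar2_mod \<Rightarrow> 'v sbar2_mod \<Rightarrow> ('v \<Rightarrow> 'v) set" where
  "sbar2_hom M N =
     {f \<in> LinearCombinations.module_hom class_ring M N \<inter> extensional (carrier M).
        \<forall>x \<in> sbar2. \<forall>v \<in> carrier M. f (act M x v) = act N x (f v)}"

definition fin_dim_on :: "'v sbar2_mod \<Rightarrow> 'v set \<Rightarrow> bool" where
  "fin_dim_on M W \<longleftrightarrow> vectorspace.fin_dim (class_ring :: complex ring) (M\<lparr>carrier := W\<rparr>)"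

definition delta2_submodule :: "'v sbar2_mod \<Rightarrow> 'v set \<Rightarrow> bool" where
  "delta2_submodule M W \<longleftrightarrow>
     VectorSpace.subspace class_ring W M \<and> (\<forall>x \<in> delta2. \<forall>w \<in> W. act M x w \<in> W)"

text \<open>The \<open>\<Delta>\<^sub>2\<close>-submodule \<open>U(\<Delta>\<^sub>2) v\<close> generated by \<open>v\<close>.\<close>

definition delta2_gen :: "'v sbar2_mod \<Rightarrow> 'v \<Rightarrow> 'v set" where
  "delta2_gen M v = \<Inter> {W. delta2_submodule M W \<and> v \<in> W}"

definition whittaker_module :: "'v sbar2_mod \<Rightarrow> bool" where
  "whittaker_module M \<longleftrightarrow>
     sbar2_module M \<and> (\<forall>v \<in> carrier M. fin_dim_on M (delta2_gen M v))"

definition of_type :: "complex \<times> complex \<Rightarrow> 'v sbar2_mod \<Rightarrow> bool" where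
  "of_type a M \<longleftrightarrow>
     (\<forall>v \<in> carrier M. \<forall>x \<in> delta2. \<exists>k::nat.
        ((\<lambda>w. act M x w \<ominus>\<^bsub>M\<^esub> phi a x \<odot>\<^bsub>M\<^esub> w) ^^ k) v = \<zero>\<^bsub>M\<^esub>)"

definition Wh :: "complex \<times> complex \<Rightarrow> 'v sbar2_mod \<Rightarrow> 'v set" where
  "Wh a M = {v \<in> carrier M. act M d1 v = fst a \<odot>\<^bsub>M\<^esub> v \<and> act M d2 v = snd a \<odot>\<^bsub>M\<^esub> v}"

text \<open>
  The type \<^typ>\<open>'v\<close> is the universe from which the carriers of the modules are drawn.
\<close>

definition Omega :: "complex \<times> complex \<Rightarrow> ('v sbar2_mod, 'v \<Rightarrow> 'v) cat" where
  "Omega a =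
     \<lparr>Obj = {M. whittaker_module M \<and> of_type a M \<and> fin_dim_on M (Wh a M)},
      Hom = sbar2_hom,
      idn = (\<lambda>M. restrict (\<lambda>v. v) (carrier M)),
      cmp = (\<lambda>L M N g f. compose (carrier L) g f)\<rparr>"

end

theory Submission
  imports Defs
begin

text \<open>
  An invertible linear change of the coordinates \<open>t\<^sub>1, t\<^sub>2\<close> carries vector fields to vector fields.
  It respects brackets, it turns the divergence of a field into the same function written in the
  new coordinates, so that constant divergence stays constant, and it acts on the span of
  \<open>\<partial>\<^sub>1, \<partial>\<^sub>2\<close> by an invertible matrix \<open>g\<close>.  It is therefore an automorphism \<open>\<sigma>\<close> of the Lie algebra
  \<^const>\<open>sbar2\<close> that preserves \<^const>\<open>delta2\<close>.

  Let a module \<open>M\<close> keep its vector space but let \<open>x\<close> act as \<open>\<sigma> x\<close>.  The result generates the same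
  \<^const>\<open>delta2\<close>-submodules, and where \<open>M\<close> has type \<open>a\<close> it has type \<open>g a\<close>, since
  \<open>phi a \<circ> \<sigma> = phi (g a)\<close> on \<^const>\<open>delta2\<close>; for the same reason its Whittaker vectors of type
  \<open>g a\<close> are the Whittaker vectors of \<open>M\<close> of type \<open>a\<close>.  A linear map commutes with all the
  actions \<open>\<sigma> x\<close> exactly if it commutes with all the actions \<open>x\<close>, so homomorphisms are unchanged.
  Twisting by \<open>\<sigma>\<close> and by its inverse thus give mutually inverse functors, an isomorphism
  of categories (lemmas \<open>equivalent_Omega\<close> and \<open>equivalent_Omega_linear\<close>).

  The theorem follows because invertible matrices act transitively on the nonzero vectors of
  \<open>\<complex>\<^sup>2\<close>: some \<open>g\<close> sends \<open>a\<close> to \<open>(1, 1)\<close>.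
\<close>

section \<open>Algebra endomorphisms and derivations of \<open>\<complex>[t\<^sub>1, t\<^sub>2]\<close>\<close>

definition t1 :: bipoly where "t1 = [:[:0, 1:]:]"
definition t2 :: bipoly where "t2 = [:0, 1:]"

lemma const2_ring [simp]:
  "const2 0 = 0" "const2 1 = 1"
  "const2 (c + d) = const2 c + const2 d" "const2 (c * d) = const2 c * const2 d"
  by (simp_all add: const2_def one_pCons)

text \<open>
  The polynomial ring is generated by the constants and the two variables.  Through this
  induction rule an identity between algebra homomorphisms, or between derivations, need only be
  checked on \<^const>\<open>t1\<close> and \<^const>\<open>t2\<close>.
\<close>

lemma bipoly_induct [case_names const t1 t2 add mult]:
  assumes const: "\<And>c. P (const2 c)"
    and t1: "P t1" and t2: "P t2"
    and add: "\<And>p q. P p \<Longrightarrow> P q \<Longrightarrow> P (p + q)"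
    and mult: "\<And>p q. P p \<Longrightarrow> P q \<Longrightarrow> P (p * q)"
  shows "P p"
proof (induction p)
  case 0
  show ?case using const [of 0] by simp
next
  case (pCons a p)
  have coeffs: "P [:a:]"
  proof (induction a)
    case 0
    show ?case using const [of 0] by simp
  next
    case (pCons c a)
    have "[:pCons c a:] = const2 c + t1 * [:a:]"
      by (simp add: const2_def t1_def)
    then show ?case using add [OF const mult [OF t1 pCons(2)]] by simp
  qed
  have "pCons a p = [:a:] + t2 * p"
    by (simp add: t2_def)
  then show ?case using add [OF coeffs mult [OF t2 pCons(2)]] by simp
qed

definition alg_hom :: "(bipoly \<Rightarrow> bipoly) \<Rightarrow> bool" where
  "alg_hom S \<longleftrightarrow> (\<forall>p q. S (p + q) = S p + S q) \<and> (\<forall>p q. S (p * q) = S p * S q) \<and>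
     (\<forall>c. S (const2 c) = const2 c)"

lemma alg_homD:
  assumes "alg_hom S"
  shows "S (p + q) = S p + S q" "S (p * q) = S p * S q" "S (const2 c) = const2 c"
  using assms by (auto simp: alg_hom_def)

lemma alg_hom_diff:
  assumes "alg_hom S"
  shows "S (p - q) = S p - S q"
  using alg_homD(1) [OF assms, of "p - q" q] by simp

lemma alg_hom_eqI:
  assumes "alg_hom S" "alg_hom T" "S t1 = T t1" "S t2 = T t2"
  shows "S p = T p"
  by (induction p rule: bipoly_induct) (simp_all add: assms alg_homD)

text \<open>
  The unique extension of a ring homomorphism \<open>h\<close> to one more variable, sent to \<open>x\<close>.  A
  substitution for both variables of \<open>\<complex>[t\<^sub>1][t\<^sub>2]\<close> is two such extensions on top of each other.
\<close>

definition eval_along :: "('a::comm_ring_1 \<Rightarrow> 'b::comm_ring_1) \<Rightarrow> 'b \<Rightarrow> 'a poly \<Rightarrow> 'b" where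
  "eval_along h x p = poly (map_poly h p) x"

lemma eval_along_ring:
  fixes h :: "'a::comm_ring_1 \<Rightarrow> 'b::comm_ring_1"
  assumes add: "\<And>a b. h (a + b) = h a + h b" and mult: "\<And>a b. h (a * b) = h a * h b"
  shows "eval_along h x (pCons a p) = h a + x * eval_along h x p" (is ?pCons)
    and "eval_along h x (p + q) = eval_along h x p + eval_along h x q"
    and "eval_along h x (p * q) = eval_along h x p * eval_along h x q"
proof -
  have h0: "h 0 = 0" using add [of 0 0] by simp
  have pCons: "eval_along h x (pCons a p) = h a + x * eval_along h x p" for a p
    by (simp add: eval_along_def map_poly_pCons h0)
  then show ?pCons .
  have zero: "eval_along h x 0 = 0" by (simp add: eval_along_def)
  show plus: "eval_along h x (p + q) = eval_along h x p + eval_along h x q" for p q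
    by (induction p q rule: poly_induct2) (simp_all add: pCons zero add algebra_simps)
  have smult: "eval_along h x (Polynomial.smult a q) = h a * eval_along h x q" for a q
    by (induction q) (simp_all add: pCons zero mult algebra_simps)
  show "eval_along h x (p * q) = eval_along h x p * eval_along h x q"
    by (induction p) (simp_all add: pCons plus smult zero h0 algebra_simps)
qed

definition substitute :: "bipoly \<Rightarrow> bipoly \<Rightarrow> bipoly \<Rightarrow> bipoly" where
  "substitute u v = eval_along (eval_along const2 u) v"

lemma substitute:
  shows alg_hom_substitute: "alg_hom (substitute u v)"
    and substitute_t1: "substitute u v t1 = u"
    and substitute_t2: "substitute u v t2 = v"
proof -
  have inner: "eval_along const2 u (pCons a p) = const2 a + u * eval_along const2 u p"
    "eval_along const2 u (p + q) = eval_along const2 u p + eval_along const2 u q"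
    "eval_along const2 u (p * q) = eval_along const2 u p * eval_along const2 u q" for a p q
    by (rule eval_along_ring; simp)+
  have outer: "substitute u v (pCons a p) = eval_along const2 u a + v * substitute u v p"
    "substitute u v (p + q) = substitute u v p + substitute u v q"
    "substitute u v (p * q) = substitute u v p * substitute u v q" for a p q
    unfolding substitute_def by (rule eval_along_ring; fact inner)+
  have zero: "eval_along const2 u 0 = 0" "substitute u v 0 = 0"
    by (simp_all add: eval_along_def substitute_def)
  have one: "eval_along const2 u 1 = 1"
    by (simp add: one_pCons inner zero)
  have const: "substitute u v (const2 c) = const2 c" for c
    by (simp add: const2_def outer inner zero)
  show "alg_hom (substitute u v)"
    unfolding alg_hom_def using outer const by blast
  show "substitute u v t1 = u" "substitute u v t2 = v"
    by (simp_all add: t1_def t2_def outer inner zero one)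
qed

definition derivation :: "(bipoly \<Rightarrow> bipoly) \<Rightarrow> bool" where
  "derivation D \<longleftrightarrow> (\<forall>p q. D (p + q) = D p + D q) \<and> (\<forall>p q. D (p * q) = p * D q + D p * q) \<and>
     (\<forall>c. D (const2 c) = 0)"

lemma derivationD:
  assumes "derivation D"
  shows "D (p + q) = D p + D q" "D (p * q) = p * D q + D p * q" "D (const2 c) = 0"
  using assms by (auto simp: derivation_def)

lemma derivation_eqI:
  assumes "derivation D" "derivation E" "D t1 = E t1" "D t2 = E t2"
  shows "D p = E p"
  by (induction p rule: bipoly_induct) (simp_all add: assms derivationD)

lemma pd1_pCons: "pd1 (pCons a p) = pCons (pderiv a) (pd1 p)"
  by (simp add: pd1_def map_poly_pCons)

lemma derivation_pd1: "derivation pd1"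
proof -
  have zero: "pd1 0 = 0" by (simp add: pd1_def)
  have add: "pd1 (p + q) = pd1 p + pd1 q" for p q
    by (induction p q rule: poly_induct2) (simp_all add: pd1_pCons zero pderiv_add)
  have smult: "pd1 (Polynomial.smult a q) =
      Polynomial.smult a (pd1 q) + Polynomial.smult (pderiv a) q" for a q
    by (induction q) (simp_all add: pd1_pCons zero pderiv_mult algebra_simps)
  have "pd1 (p * q) = p * pd1 q + pd1 p * q" for p q
    by (induction p) (simp_all add: pd1_pCons zero add smult algebra_simps)
  with add show ?thesis
    by (simp add: derivation_def const2_def pd1_pCons zero pderiv_pCons)
qed

lemma derivation_pd2: "derivation pd2"
  by (simp add: derivation_def pd2_def pderiv_add pderiv_mult const2_def pderiv_pCons algebra_simps)

lemma pd_gens [simp]: "pd1 t1 = 1" "pd1 t2 = 0" "pd2 t1 = 0" "pd2 t2 = 1"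
  by (simp_all add: pd1_def pd2_def t1_def t2_def pderiv_pCons map_poly_pCons one_pCons)

lemma derivation_vf_apply: "derivation (vf_apply x)"
  unfolding derivation_def vf_apply_def
  by (simp add: derivationD [OF derivation_pd1] derivationD [OF derivation_pd2] algebra_simps)

lemma vf_apply_gens [simp]: "vf_apply x t1 = fst x" "vf_apply x t2 = snd x"
  by (simp_all add: vf_apply_def)

lemma vf_apply_linear:
  "vf_apply (x + y) f = vf_apply x f + vf_apply y f"
  "vf_apply (vf_scale c x) f = const2 c * vf_apply x f"
  by (simp_all add: vf_apply_def vf_scale_def algebra_simps)

text \<open>
  Vector fields and derivations of the polynomial ring are the same thing.  Brackets and changes
  of coordinates are handled on the side of derivations, where they are a commutator and
  a conjugation.
\<close>

lemma derivation_eq_vf_apply: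
  assumes "derivation D"
  shows "D p = vf_apply (D t1, D t2) p"
  by (rule derivation_eqI [OF assms derivation_vf_apply]) simp_all

text \<open>
  The commutator of two derivations is a derivation, so it is the vector field with the
  commutator's values on the variables, and these are the components of the bracket.
\<close>

lemma vf_apply_bracket:
  "vf_apply (vf_bracket x y) f = vf_apply x (vf_apply y f) - vf_apply y (vf_apply x f)"
proof -
  note D = derivationD [OF derivation_vf_apply]
  have z: "vf_apply x 0 = 0" for x using D(3) [of x 0] by simp
  have "derivation (\<lambda>f. vf_apply x (vf_apply y f) - vf_apply y (vf_apply x f))"
    unfolding derivation_def by (simp add: D z algebra_simps)
  then have "vf_apply x (vf_apply y f) - vf_apply y (vf_apply x f) =
      vf_apply (vf_apply x (vf_apply y t1) - vf_apply y (vf_apply x t1),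
                vf_apply x (vf_apply y t2) - vf_apply y (vf_apply x t2)) f"
    by (rule derivation_eq_vf_apply)
  then show ?thesis by (simp add: vf_bracket_def)
qed

section \<open>Transport of vector fields along a polynomial automorphism\<close>

locale poly_automorphism =
  fixes S T :: "bipoly \<Rightarrow> bipoly"
  assumes hom_S: "alg_hom S" and hom_T: "alg_hom T"
    and ST [simp]: "S (T p) = p" and TS [simp]: "T (S p) = p"
begin

lemma derivation_conjugate:
  assumes "derivation D"
  shows "derivation (\<lambda>p. S (D (T p)))"
proof -
  have "S 0 = 0" using alg_homD(3) [OF hom_S, of 0] by simp
  then show ?thesis
    unfolding derivation_def
    by (simp add: alg_homD [OF hom_S] alg_homD [OF hom_T] derivationD [OF assms])
qed

text \<open>The vector field of the conjugated derivation \<open>S \<circ> x \<circ> T\<close>.\<close>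

definition push :: "vfield \<Rightarrow> vfield" where
  "push x = (S (vf_apply x (T t1)), S (vf_apply x (T t2)))"

lemma vf_apply_push: "vf_apply (push x) f = S (vf_apply x (T f))"
  unfolding push_def
  using derivation_eq_vf_apply [OF derivation_conjugate [OF derivation_vf_apply]] by metis

lemma push_add: "push (x + y) = push x + push y"
  by (simp add: push_def vf_apply_linear alg_homD [OF hom_S])

lemma push_scale: "push (vf_scale c x) = vf_scale c (push x)"
  by (simp add: push_def vf_apply_linear alg_homD [OF hom_S]) (simp add: vf_scale_def)

lemma push_bracket: "push (vf_bracket x y) = vf_bracket (push x) (push y)"
proof -
  have "push (vf_bracket x y) =
     (vf_apply (push x) (vf_apply (push y) t1) - vf_apply (push y) (vf_apply (push x) t1),
      vf_apply (push x) (vf_apply (push y) t2) - vf_apply (push y) (vf_apply (push x) t2))"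
    unfolding vf_apply_push by (simp add: push_def vf_apply_bracket alg_hom_diff [OF hom_S])
  then show ?thesis by (simp add: vf_bracket_def)
qed

text \<open>
  The conjugate \<open>T \<circ> D \<circ> S\<close> is a derivation, hence the vector field given by its values on the
  variables.  Applying \<open>S\<close> to this identity gives the chain rule.
\<close>

lemma chain_rule:
  assumes "derivation D"
  shows "D (S p) = S (pd1 p) * D (S t1) + S (pd2 p) * D (S t2)"
proof -
  interpret inv: poly_automorphism T S
    by unfold_locales (simp_all add: hom_S hom_T)
  have "T (D (S p)) = pd1 p * T (D (S t1)) + pd2 p * T (D (S t2))"
    using derivation_eq_vf_apply [OF inv.derivation_conjugate [OF assms], of p]
    by (simp add: vf_apply_def algebra_simps)
  then have "S (T (D (S p))) = S (pd1 p * T (D (S t1)) + pd2 p * T (D (S t2)))"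
    by simp
  then show ?thesis by (simp add: alg_homD [OF hom_S])
qed

end

lemma poly_automorphism_sym: "poly_automorphism S T \<Longrightarrow> poly_automorphism T S"
  by (simp add: poly_automorphism_def)

lemma push_push:
  assumes "poly_automorphism S T"
  shows "poly_automorphism.push S T (poly_automorphism.push T S x) = x"
proof -
  interpret poly_automorphism S T by fact
  interpret inv: poly_automorphism T S by (rule poly_automorphism_sym) fact
  show ?thesis by (simp add: push_def [of "inv.push x"] inv.vf_apply_push)
qed

section \<open>Twisting the action of a module\<close>

definition twist :: "(vfield \<Rightarrow> vfield) \<Rightarrow> 'v sbar2_mod \<Rightarrow> 'v sbar2_mod" where
  "twist \<sigma> M = M\<lparr>act := \<lambda>x. act M (\<sigma> x)\<rparr>"

lemma twist_simps [simp]: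
  "carrier (twist \<sigma> M) = carrier M" "add (twist \<sigma> M) = add M" "zero (twist \<sigma> M) = zero M"
  "smult (twist \<sigma> M) = smult M" "act (twist \<sigma> M) x = act M (\<sigma> x)"
  "a_minus (twist \<sigma> M) = a_minus M"
  "finsum (twist \<sigma> M) = finsum M"
  "(twist \<sigma> M)\<lparr>carrier := W\<rparr> = twist \<sigma> (M\<lparr>carrier := W\<rparr>)"
  by (simp_all add: twist_def a_minus_def a_inv_def finsum_def fun_eq_iff)

lemma module_twist [simp]: "Module.module R (twist \<sigma> M) \<longleftrightarrow> Module.module R M"
  by (simp add: twist_def Module.module_def module_axioms_def abelian_group_def
      abelian_monoid_def abelian_group_axioms_def)

lemma vectorspace_twist [simp]: "vectorspace K (twist \<sigma> M) \<longleftrightarrow> vectorspace K M"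
  by (simp add: vectorspace_def)

lemma subspace_twist [simp]: "VectorSpace.subspace K W (twist \<sigma> M) \<longleftrightarrow> VectorSpace.subspace K W M"
  by (simp add: VectorSpace.subspace_def submodule_def)

text \<open>
  Finite dimension depends only on the addition and the scalar multiplication, which the twist
  keeps.  The hypothesis makes \<open>W\<close> a vector space, outside of which \<open>vectorspace.fin_dim\<close> has no
  known value.
\<close>

lemma fin_dim_on_twist:
  assumes "VectorSpace.subspace class_ring W M"
  shows "fin_dim_on (twist \<sigma> M) W \<longleftrightarrow> fin_dim_on M W"
proof -
  interpret V: vectorspace class_ring M
    using assms by (simp add: VectorSpace.subspace_def)
  interpret W: vectorspace class_ring "M\<lparr>carrier := W\<rparr>"
    using assms by (rule V.subspace_is_vs)
  interpret W': vectorspace class_ring "twist \<sigma> (M\<lparr>carrier := W\<rparr>)"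
    by (simp add: W.vectorspace_axioms)
  have "W'.lincomb = W.lincomb"
    by (simp add: fun_eq_iff W.lincomb_def W'.lincomb_def)
  then have "W'.span = W.span"
    by (simp add: fun_eq_iff W.span_def W'.span_def)
  then show ?thesis
    by (simp add: fin_dim_on_def W.fin_dim_def W'.fin_dim_def)
qed

lemma subspace_carrier:
  assumes "vectorspace K M"
  shows "VectorSpace.subspace K (carrier M) M"
proof -
  interpret vectorspace K M by fact
  show ?thesis by unfold_locales auto
qed

lemma subspace_Inter:
  assumes "vectorspace K M" "\<W> \<noteq> {}" "\<And>W. W \<in> \<W> \<Longrightarrow> VectorSpace.subspace K W M"
  shows "VectorSpace.subspace K (\<Inter>\<W>) M"
proof -
  obtain W where "W \<in> \<W>" using assms(2) by blast
  then have "\<Inter>\<W> \<subseteq> carrier M" "Module.module K M"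
    using assms(3) [of W] by (auto simp: VectorSpace.subspace_def submodule_def)
  with assms(1,3) show ?thesis
    by (simp add: VectorSpace.subspace_def submodule_def)
qed

section \<open>Subspaces attached to \<open>\<Delta>\<^sub>2\<close>\<close>

lemma delta2_eq: "delta2 = {(const2 c, const2 d) | c d. True}"
  by (simp add: delta2_def d1_def d2_def vf_scale_def)

lemma phi_const: "phi a (const2 c, const2 d) = c * fst a + d * snd a"
  by (simp add: phi_def const2_def)

lemma delta2_sbar2: "x \<in> delta2 \<Longrightarrow> x \<in> sbar2"
  by (auto simp: delta2_eq sbar2_def divergence_def derivationD [OF derivation_pd1]
      derivationD [OF derivation_pd2] intro: range_eqI [of _ _ 0])

lemma gens_mem: "d1 \<in> delta2" "d2 \<in> delta2"
  unfolding delta2_eq d1_def d2_def by (auto intro: const2_ring(1,2))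

lemma subspace_delta2_gen:
  assumes "sbar2_module M" "v \<in> carrier M"
  shows "VectorSpace.subspace class_ring (delta2_gen M v) M"
proof -
  interpret sbar2_module M by fact
  have "delta2_submodule M (carrier M)"
    by (auto simp: delta2_submodule_def subspace_carrier vectorspace_axioms
        intro!: act_closed delta2_sbar2)
  then show ?thesis unfolding delta2_gen_def
    using assms(2) by (intro subspace_Inter vectorspace_axioms) (auto simp: delta2_submodule_def)
qed

lemma phi_comb: "phi a (vf_scale c d1 + vf_scale e d2) = c * fst a + e * snd a"
  by (simp add: phi_def d1_def d2_def vf_scale_def const2_def)

lemma phi_gens: "phi a d1 = fst a" "phi a d2 = snd a"
  by (simp_all add: phi_def d1_def d2_def)

lemma vf_scale_sbar2:
  assumes "x \<in> sbar2"
  shows "vf_scale c x \<in> sbar2"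
proof -
  have "divergence (vf_scale c x) = const2 c * divergence x"
    by (simp add: divergence_def vf_scale_def derivationD [OF derivation_pd1]
        derivationD [OF derivation_pd2] algebra_simps)
  with assms show ?thesis
    by (auto simp: sbar2_def simp del: const2_ring simp flip: const2_ring(4))
qed

text \<open>
  Quantifying over all of \<^const>\<open>delta2\<close> instead of the basis \<^const>\<open>d1\<close>, \<^const>\<open>d2\<close> makes the condition
  visibly invariant under automorphisms that preserve \<^const>\<open>delta2\<close> but move this basis.
\<close>

lemma Wh_eq:
  assumes "sbar2_module M"
  shows "Wh a M = {v \<in> carrier M. \<forall>x \<in> delta2. act M x v = phi a x \<odot>\<^bsub>M\<^esub> v}"
proof -
  interpret sbar2_module M by fact
  have "act M x v = phi a x \<odot>\<^bsub>M\<^esub> v"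
    if v: "v \<in> carrier M" "act M d1 v = fst a \<odot>\<^bsub>M\<^esub> v" "act M d2 v = snd a \<odot>\<^bsub>M\<^esub> v"
      and x: "x \<in> delta2" for x v
  proof -
    obtain c e where x: "x = vf_scale c d1 + vf_scale e d2"
      using x by (auto simp: delta2_def)
    note sb = gens_mem [THEN delta2_sbar2]
    have "act M x v = c \<odot>\<^bsub>M\<^esub> (fst a \<odot>\<^bsub>M\<^esub> v) \<oplus>\<^bsub>M\<^esub> e \<odot>\<^bsub>M\<^esub> (snd a \<odot>\<^bsub>M\<^esub> v)"
      by (simp add: x act_add_left act_scale_left vf_scale_sbar2 sb v)
    also have "\<dots> = (c * fst a + e * snd a) \<odot>\<^bsub>M\<^esub> v"
      using v(1) smult_assoc1 [of _ _ v] smult_l_distr [of _ _ v] by simp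
    finally show ?thesis by (simp add: x phi_comb)
  qed
  then show ?thesis
    by (auto simp: Wh_def gens_mem phi_gens)
qed

lemma subspace_Wh:
  assumes "sbar2_module M"
  shows "VectorSpace.subspace class_ring (Wh a M) M"
proof -
  interpret sbar2_module M by fact
  note sb = gens_mem [THEN delta2_sbar2]
  have zero: "act M x \<zero>\<^bsub>M\<^esub> = \<zero>\<^bsub>M\<^esub>" if "x \<in> sbar2" for x
    using act_smult_right [OF that, of "\<zero>\<^bsub>M\<^esub>" 0] act_closed [OF that, of "\<zero>\<^bsub>M\<^esub>"] lmult_0 by simp
  have comm: "c \<odot>\<^bsub>M\<^esub> (e \<odot>\<^bsub>M\<^esub> v) = e \<odot>\<^bsub>M\<^esub> (c \<odot>\<^bsub>M\<^esub> v)" if "v \<in> carrier M" for c e v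
    using that smult_assoc1 [of c e v] smult_assoc1 [of e c v] by (simp add: mult.commute)
  show ?thesis
    unfolding VectorSpace.subspace_def submodule_def
    using vectorspace_axioms module_axioms
    by (auto simp: Wh_def sb zero act_add_right act_smult_right smult_r_distr comm)
qed

section \<open>Automorphisms that preserve \<open>\<Delta>\<^sub>2\<close> induce equivalences\<close>

lemma category_Omega: "category (Omega a)"
proof
  fix X :: "'v sbar2_mod"
  assume "X \<in> Obj (Omega a)"
  then interpret sbar2_module X by (simp add: Omega_def whittaker_module_def)
  show "idn (Omega a) X \<in> Hom (Omega a) X X"
    by (auto simp: Omega_def sbar2_hom_def LinearCombinations.module_hom_def act_closed)
next
  fix X Y Z :: "'v sbar2_mod" and f g
  assume "X \<in> Obj (Omega a)" "Y \<in> Obj (Omega a)" "Z \<in> Obj (Omega a)"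
    and fg: "f \<in> Hom (Omega a) X Y" "g \<in> Hom (Omega a) Y Z"
  then interpret X: sbar2_module X by (simp add: Omega_def whittaker_module_def)
  show "cmp (Omega a) X Y Z g f \<in> Hom (Omega a) X Z"
    using fg by (auto simp: Omega_def sbar2_hom_def LinearCombinations.module_hom_def X.act_closed
        compose_def Pi_iff)
qed (auto simp: Omega_def sbar2_hom_def LinearCombinations.module_hom_def compose_def Pi_iff
    extensional_def fun_eq_iff)

text \<open>
  The inverse is a parameter of the locale, so that every fact about \<open>\<sigma>\<close> is available for \<open>\<tau>\<close> by
  interpreting the locale with the two exchanged.
\<close>

locale sbar2_automorphism =
  fixes \<sigma> \<tau> :: "vfield \<Rightarrow> vfield"
  assumes inverse [simp]: "\<sigma> (\<tau> x) = x" "\<tau> (\<sigma> x) = x"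
    and add: "\<sigma> (x + y) = \<sigma> x + \<sigma> y" "\<tau> (x + y) = \<tau> x + \<tau> y"
    and scale: "\<sigma> (vf_scale c x) = vf_scale c (\<sigma> x)" "\<tau> (vf_scale c x) = vf_scale c (\<tau> x)"
    and bracket: "\<sigma> (vf_bracket x y) = vf_bracket (\<sigma> x) (\<sigma> y)"
      "\<tau> (vf_bracket x y) = vf_bracket (\<tau> x) (\<tau> y)"
    and sbar2: "x \<in> sbar2 \<Longrightarrow> \<sigma> x \<in> sbar2" "x \<in> sbar2 \<Longrightarrow> \<tau> x \<in> sbar2"
    and delta2: "x \<in> delta2 \<Longrightarrow> \<sigma> x \<in> delta2" "x \<in> delta2 \<Longrightarrow> \<tau> x \<in> delta2"
begin

lemma symmetric: "sbar2_automorphism \<tau> \<sigma>"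
  by unfold_locales (simp_all add: add scale bracket sbar2 delta2)

lemma twist_twist: "twist \<tau> (twist \<sigma> M) = M"
  by (simp add: twist_def)

lemma ball_sbar2: "(\<forall>x\<in>sbar2. P (\<sigma> x)) \<longleftrightarrow> (\<forall>x\<in>sbar2. P x)"
  using sbar2 inverse by metis

lemma ball_delta2: "(\<forall>x\<in>delta2. P (\<sigma> x)) \<longleftrightarrow> (\<forall>x\<in>delta2. P x)"
  using delta2 inverse by metis

lemma sbar2_module_twist: "sbar2_module M \<Longrightarrow> sbar2_module (twist \<sigma> M)"
proof -
  assume "sbar2_module M"
  then interpret sbar2_module M .
  show "sbar2_module (twist \<sigma> M)"
    by (intro sbar2_module.intro sbar2_module_axioms.intro)
      (simp_all add: vectorspace_axioms add scale bracket sbar2 act_closed act_add_left act_add_right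
        act_scale_left act_smult_right act_bracket)
qed

lemma sbar2_hom_twist: "sbar2_hom (twist \<sigma> M) (twist \<sigma> N) = sbar2_hom M N"
  by (simp add: sbar2_hom_def LinearCombinations.module_hom_def
      ball_sbar2 [where P = "\<lambda>x. \<forall>v\<in>carrier M. _ (act M x v) = act N x (_ v)"])

lemma delta2_gen_twist: "delta2_gen (twist \<sigma> M) v = delta2_gen M v"
  by (simp add: delta2_gen_def delta2_submodule_def
      ball_delta2 [where P = "\<lambda>x. \<forall>w\<in>_. act M x w \<in> _"])

lemma whittaker_module_twist:
  assumes "whittaker_module M"
  shows "whittaker_module (twist \<sigma> M)"
  using assms
  by (simp add: whittaker_module_def sbar2_module_twist delta2_gen_twist fin_dim_on_twist
      subspace_delta2_gen)

lemma Omega_twist: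
  assumes M: "M \<in> Obj (Omega a)" and phi: "\<And>x. x \<in> delta2 \<Longrightarrow> phi b x = phi a (\<sigma> x)"
  shows "twist \<sigma> M \<in> Obj (Omega b)"
proof -
  have mod: "sbar2_module M" and type: "of_type a M" and fin: "fin_dim_on M (Wh a M)"
    and W: "whittaker_module M"
    using M by (auto simp: Omega_def whittaker_module_def)
  have "Wh b (twist \<sigma> M) = Wh a M"
    using ball_delta2 [where P = "\<lambda>x. act M x _ = phi a x \<odot>\<^bsub>M\<^esub> _"]
    by (simp add: Wh_eq mod sbar2_module_twist phi)
  moreover have "of_type b (twist \<sigma> M)"
    using type by (simp add: of_type_def phi delta2)
  ultimately show ?thesis
    using fin by (simp add: Omega_def whittaker_module_twist W fin_dim_on_twist mod subspace_Wh)
qed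

text \<open>
  Both composites of the twists by \<open>\<sigma>\<close> and by \<open>\<tau>\<close> are equal to the identity, on objects by
  \<open>twist_twist\<close> and on morphisms because both functors leave the underlying maps alone.  The
  required natural isomorphisms are therefore identities.
\<close>

lemma equivalent_Omega:
  assumes phi: "\<And>x. x \<in> delta2 \<Longrightarrow> phi b x = phi a (\<sigma> x)"
  shows "equivalent_categories (Omega a :: ('v sbar2_mod, 'v \<Rightarrow> 'v) cat)
                               (Omega b :: ('v sbar2_mod, 'v \<Rightarrow> 'v) cat)"
proof -
  interpret inv: sbar2_automorphism \<tau> \<sigma> by (rule symmetric)
  have phi': "phi a x = phi b (\<tau> x)" if "x \<in> delta2" for x
    by (simp add: phi delta2 that)
  have hom: "Hom (Omega c) = sbar2_hom" "idn (Omega c) = (\<lambda>M. restrict (\<lambda>v. v) (carrier M))"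
    "cmp (Omega c) = (\<lambda>L M N g f. compose (carrier L) g f)" for c
    by (simp_all add: Omega_def)
  have F: "is_functor (Omega a) (Omega b) (twist \<sigma>) (\<lambda>X Y f. f)"
    by (auto simp: is_functor_def Omega_twist phi hom sbar2_hom_twist)
  have G: "is_functor (Omega b) (Omega a) (twist \<tau>) (\<lambda>X Y f. f)"
    by (auto simp: is_functor_def inv.Omega_twist phi' hom inv.sbar2_hom_twist)
  have id: "is_nat_iso (Omega c) (Omega c) (\<lambda>X. X) (\<lambda>X Y f. f) (\<lambda>X. X) (\<lambda>X Y f. f)
      (idn (Omega c :: ('v sbar2_mod, 'v \<Rightarrow> 'v) cat))"
    for c :: "complex \<times> complex"
  proof -
    interpret category "Omega c :: ('v sbar2_mod, 'v \<Rightarrow> 'v) cat" by (rule category_Omega)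
    show ?thesis
      by (auto simp: is_nat_iso_def iso_in_def idn_in_Hom cmp_idn_left cmp_idn_right
          intro!: bexI [OF _ idn_in_Hom])
  qed
  show ?thesis
    unfolding equivalent_categories_def
  proof (intro conjI category_Omega exI)
    show "is_functor (Omega a :: ('v sbar2_mod, 'v \<Rightarrow> 'v) cat) (Omega b) (twist \<sigma>) (\<lambda>X Y f. f)"
      by (rule F)
    show "is_functor (Omega b :: ('v sbar2_mod, 'v \<Rightarrow> 'v) cat) (Omega a) (twist \<tau>) (\<lambda>X Y f. f)"
      by (rule G)
    show "is_nat_iso (Omega a) (Omega a) (\<lambda>X. X) (\<lambda>X Y f. f) (\<lambda>X. twist \<tau> (twist \<sigma> X))
        (\<lambda>X Y f. f) (idn (Omega a :: ('v sbar2_mod, 'v \<Rightarrow> 'v) cat))"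
      by (simp add: twist_twist id)
    show "is_nat_iso (Omega b) (Omega b) (\<lambda>X. twist \<sigma> (twist \<tau> X)) (\<lambda>X Y f. f) (\<lambda>X. X)
        (\<lambda>X Y f. f) (idn (Omega b :: ('v sbar2_mod, 'v \<Rightarrow> 'v) cat))"
      by (simp add: inv.twist_twist id)
  qed
qed

end

section \<open>Linear changes of coordinates\<close>

text \<open>
  The coefficients of the image of \<open>t\<^sub>j\<close> are the \<open>j\<close>-th column of the matrix.
\<close>

definition linear_subst :: "complex \<Rightarrow> complex \<Rightarrow> complex \<Rightarrow> complex \<Rightarrow> bipoly \<Rightarrow> bipoly" where
  "linear_subst m11 m12 m21 m22 =
     substitute (const2 m11 * t1 + const2 m21 * t2) (const2 m12 * t1 + const2 m22 * t2)"

lemma linear_subst_gens: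
  "linear_subst m11 m12 m21 m22 t1 = const2 m11 * t1 + const2 m21 * t2"
  "linear_subst m11 m12 m21 m22 t2 = const2 m12 * t1 + const2 m22 * t2"
  by (simp_all add: linear_subst_def substitute_t1 substitute_t2)

text \<open>
  Mutually inverse matrices \<open>g\<close> and \<open>h\<close>.  The substitution \<open>T\<close> belongs to \<open>g\<close> and its
  inverse \<open>S\<close> to \<open>h\<close>: with the column convention of \<^const>\<open>linear_subst\<close>, pushing forward along
  \<open>S\<close> then takes \<open>\<partial>\<^sub>i\<close> to \<open>g\<^sub>i\<^sub>1 \<partial>\<^sub>1 + g\<^sub>i\<^sub>2 \<partial>\<^sub>2\<close>.
\<close>

locale linear_change =
  fixes g11 g12 g21 g22 h11 h12 h21 h22 :: complex
  assumes gh: "g11 * h11 + g12 * h21 = 1" "g11 * h12 + g12 * h22 = 0"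
      "g21 * h11 + g22 * h21 = 0" "g21 * h12 + g22 * h22 = 1"
    and hg: "h11 * g11 + h12 * g21 = 1" "h11 * g12 + h12 * g22 = 0"
      "h21 * g11 + h22 * g21 = 0" "h21 * g12 + h22 * g22 = 1"
begin

abbreviation S :: "bipoly \<Rightarrow> bipoly" where
  "S \<equiv> linear_subst h11 h12 h21 h22"

abbreviation T :: "bipoly \<Rightarrow> bipoly" where
  "T \<equiv> linear_subst g11 g12 g21 g22"

lemma gh2: "const2 g11 * const2 h11 + const2 g12 * const2 h21 = 1"
      "const2 g11 * const2 h12 + const2 g12 * const2 h22 = 0"
      "const2 g21 * const2 h11 + const2 g22 * const2 h21 = 0"
      "const2 g21 * const2 h12 + const2 g22 * const2 h22 = 1"
  using gh [THEN arg_cong [where f = const2]] by simp_all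

lemma hg2: "const2 h11 * const2 g11 + const2 h12 * const2 g21 = 1"
      "const2 h11 * const2 g12 + const2 h12 * const2 g22 = 0"
      "const2 h21 * const2 g11 + const2 h22 * const2 g21 = 0"
      "const2 h21 * const2 g12 + const2 h22 * const2 g22 = 1"
  using hg [THEN arg_cong [where f = const2]] by simp_all

sublocale poly_automorphism S T
proof
  show hom_S: "alg_hom S" and hom_T: "alg_hom T"
    by (simp_all add: linear_subst_def alg_hom_substitute)
  note [simp] = alg_homD [OF hom_S] alg_homD [OF hom_T] linear_subst_gens
  have ST: "alg_hom (\<lambda>p. S (T p))" and TS: "alg_hom (\<lambda>p. T (S p))" and id: "alg_hom (\<lambda>p. p)"
    by (simp_all add: alg_hom_def)
  have collect: "A * (B * t1 + C * t2) + D * (E * t1 + F * t2) =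
      (B * A + E * D) * t1 + (C * A + F * D) * t2"
    for A B C D E F :: bipoly by (simp add: algebra_simps)
  show "S (T p) = p" for p
    by (rule alg_hom_eqI [OF ST id]) (simp_all add: collect hg2)
  show "T (S p) = p" for p
    by (rule alg_hom_eqI [OF TS id]) (simp_all add: collect gh2)
qed

lemma push_eq:
  "push x = (const2 g11 * S (fst x) + const2 g21 * S (snd x),
             const2 g12 * S (fst x) + const2 g22 * S (snd x))"
  by (simp add: push_def linear_subst_gens derivationD [OF derivation_vf_apply] alg_homD [OF hom_S])

text \<open>
  The chain rule contributes the factors \<open>h\<^sub>j\<^sub>l\<close> and the transport of components the factors
  \<open>g\<^sub>i\<^sub>j\<close>.  Summing over \<open>j\<close>, the coefficient of \<open>S (\<partial>\<^sub>l x\<^sub>i)\<close> is the entry \<open>(i, l)\<close> of the identity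
  matrix \<open>g h\<close>, so only \<open>S (\<partial>\<^sub>1 x\<^sub>1 + \<partial>\<^sub>2 x\<^sub>2)\<close> survives.
\<close>

lemma divergence_push: "divergence (push x) = S (divergence x)"
proof -
  note D = derivationD [OF derivation_pd1] derivationD [OF derivation_pd2]
  have 1: "pd1 (S p) = const2 h11 * S (pd1 p) + const2 h12 * S (pd2 p)"
    and 2: "pd2 (S p) = const2 h21 * S (pd1 p) + const2 h22 * S (pd2 p)" for p
    by (simp_all add: chain_rule [OF derivation_pd1] chain_rule [OF derivation_pd2]
        linear_subst_gens D)
  obtain p q where x: "x = (p, q)" by (cases x)
  have "divergence (push x) =
      (const2 g11 * const2 h11 + const2 g12 * const2 h21) * S (pd1 p)
    + (const2 g11 * const2 h12 + const2 g12 * const2 h22) * S (pd2 p)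
    + (const2 g21 * const2 h11 + const2 g22 * const2 h21) * S (pd1 q)
    + (const2 g21 * const2 h12 + const2 g22 * const2 h22) * S (pd2 q)"
    by (simp add: x divergence_def push_eq D 1 2 algebra_simps)
  then show ?thesis by (simp add: x gh2 divergence_def alg_homD [OF hom_S])
qed

lemma push_const:
  "push (const2 c, const2 d) = (const2 (c * g11 + d * g21), const2 (c * g12 + d * g22))"
  by (simp add: push_eq alg_homD [OF hom_S] algebra_simps)

lemma push_sbar2: "x \<in> sbar2 \<Longrightarrow> push x \<in> sbar2"
  by (auto simp: sbar2_def divergence_push alg_homD [OF hom_S])

lemma push_delta2: "x \<in> delta2 \<Longrightarrow> push x \<in> delta2"
  by (auto simp: delta2_eq push_const simp del: const2_ring)

lemma phi_push:
  assumes "x \<in> delta2"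
  shows "phi a (push x) = phi (g11 * fst a + g12 * snd a, g21 * fst a + g22 * snd a) x"
proof -
  obtain c d where "x = (const2 c, const2 d)" using assms by (auto simp: delta2_eq)
  then show ?thesis
    by (simp add: push_const phi_const algebra_simps del: const2_ring)
qed

lemma sbar2_automorphism_push: "sbar2_automorphism push (poly_automorphism.push T S)"
proof -
  interpret inv: linear_change h11 h12 h21 h22 g11 g12 g21 g22
    by unfold_locales (fact hg gh)+
  show ?thesis
    by unfold_locales
      (simp_all add: push_push poly_automorphism_axioms inv.poly_automorphism_axioms
        push_add inv.push_add push_scale inv.push_scale push_bracket inv.push_bracket
        push_sbar2 inv.push_sbar2 push_delta2 inv.push_delta2)
qed

lemma equivalent_Omega_linear:
  "equivalent_categories (Omega a :: ('v sbar2_mod, 'v \<Rightarrow> 'v) cat)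
     (Omega (g11 * fst a + g12 * snd a, g21 * fst a + g22 * snd a) :: ('v sbar2_mod, 'v \<Rightarrow> 'v) cat)"
  by (rule sbar2_automorphism.equivalent_Omega [OF sbar2_automorphism_push]) (simp add: phi_push)

end

theorem lemma4p2:
  fixes a :: "complex \<times> complex"
  assumes "a \<noteq> (0, 0)"
  shows "equivalent_categories (Omega a :: ('v sbar2_mod, 'v \<Rightarrow> 'v) cat)
                               (Omega (1, 1) :: ('v sbar2_mod, 'v \<Rightarrow> 'v) cat)"
proof (cases "fst a = 0")
  case False
  \<comment> \<open>Both rows of \<open>g\<close> must have product 1 with \<open>a\<close>.  The first uses only the nonzero entry
    of \<open>a\<close>; the second has last entry 1 and is completed accordingly, which makes the
    determinant \<open>1 / fst a\<close>.\<close>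
  interpret linear_change "1 / fst a" 0 "(1 - snd a) / fst a" 1 "fst a" 0 "snd a - 1" 1
    by unfold_locales (use False in \<open>simp_all add: field_simps\<close>)
  show ?thesis
    using equivalent_Omega_linear [of a] False by simp
next
  case True
  then have a2: "snd a \<noteq> 0" using assms by (cases a) auto
  \<comment> \<open>Here the first entry of a row is free: 0 and 1 make the rows of \<open>g\<close> independent.\<close>
  interpret linear_change 0 "1 / snd a" 1 "1 / snd a" "- 1" 1 "snd a" 0
    by unfold_locales (use a2 in \<open>simp_all add: field_simps\<close>)
  show ?thesis
    using equivalent_Omega_linear [of a] True a2 by simp
qed

end
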